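(* For each integer $t\ge 2$ there exists $m_0=m_0(t)$ such that for all integers $m\ge m_0$, $$g(m,t)\ \leq\ 4^{1-1/2^{2t}}\left(\sqrt{m}+\sqrt{2t}\right)^{2-1/2^{2t-1}}.$$
   Context: Write $\mathbb{Z}_m=\mathbb{Z}/m\mathbb{Z}$. For integers $m,t\ge 2$ with $m\ge 2t$ and a $(2t)$-element subset $X$ of $\mathbb{Z}_m$, let $C(X)=\{\sum_{x\in T}x : T\subset X,\ |T|=t\}\subset\mathbb{Z}_m$ be the set of sums of $t$ distinct elements of $X$. Then $g(m,t)$ denotes the maximum possible size of a subset $R\subset\mathbb{Z}_m$ such that for every $x_0\in\mathbb{Z}_m$ and every $(2t)$-element subset $X\subset\mathbb{Z}_m$, we have $x_0+C(X)\not\subset R$. *)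

theory Defs
  imports Complex_Main
begin

text \<open>The group of integers modulo \<open>m\<close> is represented by the least non-negative residues,
  with all sums reduced by \<open>mod\<close>.\<close>

definition Zmod :: "nat \<Rightarrow> int set" where
  "Zmod m = {0..<int m}"

definition midlayer_sums :: "nat \<Rightarrow> nat \<Rightarrow> int set \<Rightarrow> int set" where
  "midlayer_sums m t X = {(\<Sum>x\<in>T. x) mod int m |T. T \<subseteq> X \<and> card T = t}"

definition translate :: "nat \<Rightarrow> int \<Rightarrow> int set \<Rightarrow> int set" where
  "translate m x0 C = (\<lambda>c. (x0 + c) mod int m) ` C"

definition midlayer_free :: "nat \<Rightarrow> nat \<Rightarrow> int set \<Rightarrow> bool" where
  "midlayer_free m t R \<longleftrightarrow>
     (\<forall>x0\<in>Zmod m. \<forall>X. X \<subseteq> Zmod m \<and> card X = 2 * t \<longrightarrow>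
        \<not> translate m x0 (midlayer_sums m t X) \<subseteq> R)"

text \<open>Only meaningful for \<open>2 \<le> t\<close> and \<open>2 * t \<le> m\<close>.  The maximum is over a finite set that is
  nonempty, since the empty set \<open>R\<close> is admissible.\<close>

definition g :: "nat \<Rightarrow> nat \<Rightarrow> nat" where
  "g m t = Max {card R |R. R \<subseteq> Zmod m \<and> midlayer_free m t R}"

end

theory Submission
  imports Defs
begin

text \<open>The proof is the density argument behind Hilbert's cube lemma.  A set \<open>R\<close> of \<open>r\<close> residues
  has \<open>r\<^sup>2\<close> ordered pairs, so some difference \<open>h\<close> is realised by about \<open>r\<^sup>2 / m\<close> of them.
  Replacing \<open>R\<close> by the set of those \<open>x \<in> R\<close> with \<open>x + h \<in> R\<close> and repeating this \<open>2 t\<close> times yields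
  generators \<open>h\<^sub>1, \<dots>, h\<^sub>2\<^sub>t\<close> and a base point \<open>x\<^sub>0\<close> such that \<^emph>\<open>all\<close> subset sums, not just those of
  \<open>t\<close> generators, translate into \<open>R\<close>.

  The generators must be distinct.  Since few differences are forbidden, each accounting for at most
  \<open>r\<close> pairs, avoiding them costs at most half of all pairs (\<open>popular_difference\<close>).  The
  size therefore drops from \<open>r\<close> to at least \<open>r\<^sup>2 / (2 m)\<close> in each step, and \<open>d\<close> steps
  end in a nonempty set once \<open>m \<ge> d\<^sup>2\<close> and \<open>r\<close> is at least \<open>(4 m)\<close> to the power \<open>1 - 1 / 2\<^sup>d\<close>
  (\<open>distinct_hilbert_cube\<close>).
  For \<open>d = 2 t\<close> this threshold is at most the claimed bound, because \<open>4 m\<close> is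
  \<open>4\<close> times the square of \<open>sqrt m\<close>, and \<open>sqrt m \<le> sqrt m + sqrt (2 t)\<close>.\<close>

lemma finite_Zmod [simp]: "finite (Zmod m)"
  by (simp add: Zmod_def)

lemma card_Zmod [simp]: "card (Zmod m) = m"
  by (simp add: Zmod_def)

lemma card_preimage_rotation:
  assumes R: "R \<subseteq> Zmod m" and x: "x \<in> Zmod m"
  shows "card {h \<in> Zmod m. (x + h) mod int m \<in> R} = card R"
proof (rule bij_betw_same_card)
  show "bij_betw (\<lambda>h. (x + h) mod int m) {h \<in> Zmod m. (x + h) mod int m \<in> R} R"
  proof (rule bij_betw_byWitness[where f' = "\<lambda>y. (y - x) mod int m"])
    show "\<forall>h\<in>{h \<in> Zmod m. (x + h) mod int m \<in> R}. ((x + h) mod int m - x) mod int m = h"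
      by (auto simp: Zmod_def mod_diff_left_eq)
    show "\<forall>y\<in>R. (x + (y - x) mod int m) mod int m = y"
      using R by (auto simp: Zmod_def mod_add_right_eq subset_eq)
    then show "(\<lambda>y. (y - x) mod int m) ` R \<subseteq> {h \<in> Zmod m. (x + h) mod int m \<in> R}"
      using x by (auto simp: Zmod_def)
  qed auto
qed

text \<open>Double counting of the pairs \<open>(x, x + h)\<close> in \<open>R \<times> R\<close>: over all \<open>h\<close> there are \<open>(card R)\<^sup>2\<close>,
  and the forbidden \<open>h\<close> in \<open>D\<close> contribute at most \<open>card D * card R\<close>, which is at most half.
  The remaining half is shared by at most \<open>m\<close> differences.\<close>

lemma popular_difference:
  assumes R: "R \<subseteq> Zmod m" and D: "D \<subseteq> Zmod m"
    and small: "2 * card D \<le> card R" and pos: "0 < card R"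
  shows "\<exists>h\<in>Zmod m - D. (card R)\<^sup>2 \<le> 2 * m * card {x \<in> R. (x + h) mod int m \<in> R}"
proof (rule ccontr)
  define r where "r = card R"
  define c where "c h = card {x \<in> R. (x + h) mod int m \<in> R}" for h
  assume unpopular: "\<not> ?thesis"
  have few: "2 * m * c h \<le> r\<^sup>2 - 1" if "h \<in> Zmod m - D" for h
  proof -
    have "2 * m * c h < r\<^sup>2"
      using unpopular that unfolding c_def r_def by (meson not_le)
    then show ?thesis
      by linarith
  qed
  have finR: "finite R" and finD: "finite D"
    using R D finite_subset finite_Zmod by blast+
  have "(\<Sum>h\<in>Zmod m. c h) = (\<Sum>x\<in>R. card {h \<in> Zmod m. (x + h) mod int m \<in> R})"
    unfolding c_def using finR
    by (intro sum_multicount_gen[symmetric]) auto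
  also have "\<dots> = r\<^sup>2"
    using R card_preimage_rotation[OF R] by (simp add: r_def power2_eq_square subset_eq)
  finally have total: "(\<Sum>h\<in>Zmod m. c h) = r\<^sup>2" .
  have "(\<Sum>h\<in>D. c h) \<le> card D * r"
    using sum_bounded_above[of D c r] finR by (simp add: c_def r_def card_mono)
  moreover have "(\<Sum>h\<in>Zmod m. c h) = (\<Sum>h\<in>Zmod m - D. c h) + (\<Sum>h\<in>D. c h)"
    using D by (intro sum.subset_diff) auto
  moreover have "2 * (card D * r) \<le> r\<^sup>2"
    using small mult_right_mono[of "2 * card D" r r] by (simp add: r_def power2_eq_square)
  ultimately have "r\<^sup>2 \<le> 2 * (\<Sum>h\<in>Zmod m - D. c h)"
    using total by linarith
  then have "m * r\<^sup>2 \<le> (\<Sum>h\<in>Zmod m - D. 2 * m * c h)"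
    using mult_left_mono[of "r\<^sup>2" "2 * (\<Sum>h\<in>Zmod m - D. c h)" m]
    by (simp add: sum_distrib_left mult_ac)
  also have "\<dots> \<le> card (Zmod m - D) * (r\<^sup>2 - 1)"
    using sum_bounded_above[of "Zmod m - D" "\<lambda>h. 2 * m * c h"] few by simp
  also have "\<dots> \<le> m * (r\<^sup>2 - 1)"
    using card_mono[of "Zmod m" "Zmod m - D"] by (intro mult_right_mono) auto
  also have "\<dots> < m * r\<^sup>2"
  proof -
    have "m \<noteq> 0"
      using R pos by (cases m) (auto simp: Zmod_def)
    then show ?thesis
      using pos by (simp add: r_def)
  qed
  finally show False by simp
qed

text \<open>The induction removes one generator at a time and adds it to the forbidden set \<open>D\<close>, which
  keeps the generators distinct.  The size hypothesis says that \<open>card R\<close> is at least \<open>(4 m)\<close> to the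
  power \<open>1 - 1 / 2\<^sup>k\<close>, and passes from \<open>r\<close> and \<open>k + 1\<close> to \<open>r\<^sup>2 / (2 m)\<close> and \<open>k\<close>.
  For \<open>k > 0\<close> it also forces \<open>(card R)\<^sup>2 \<ge> 4 m\<close>, so the bound on \<open>card D + k\<close>
  makes \<open>D\<close> small enough for \<open>popular_difference\<close>.\<close>

lemma distinct_hilbert_cube:
  assumes "R \<subseteq> Zmod m" "D \<subseteq> Zmod m" "(card D + k)\<^sup>2 \<le> m" "0 < m"
    and "(4 * m) ^ (2 ^ k - 1) \<le> card R ^ 2 ^ k"
  shows "\<exists>x0\<in>Zmod m. \<exists>X. X \<subseteq> Zmod m - D \<and> card X = k \<and>
           (\<forall>T\<subseteq>X. (x0 + \<Sum>T) mod int m \<in> R)"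
  using assms
proof (induction k arbitrary: R D)
  case 0
  then have "R \<noteq> {}"
    by auto
  then obtain x where "x \<in> R"
    by blast
  with 0 show ?case
    by (intro bexI[of _ x] exI[of _ "{}"]) (auto simp: Zmod_def subset_eq)
next
  case (Suc k)
  define r where "r = card R"
  let ?K = "2 ^ k :: nat"
  have exps: "2 ^ Suc k - 1 = ?K + (?K - 1)" "(2::nat) ^ Suc k = 2 * ?K" "?K > 0"
    by auto
  have size: "(4 * m) ^ (?K + (?K - 1)) \<le> (r\<^sup>2) ^ ?K"
    using Suc.prems(5) unfolding exps(1) unfolding exps(2) by (simp add: r_def power_mult)
  have "(4 * m) ^ ?K \<le> (4 * m) ^ (?K + (?K - 1))"
    using Suc.prems(4) by (intro power_increasing) auto
  then have "(4 * m) ^ ?K \<le> (r\<^sup>2) ^ ?K"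
    using size by linarith
  then have sq: "4 * m \<le> r\<^sup>2"
    using exps(3) by (metis not_le power_strict_mono zero_le)
  have "(2 * card D)\<^sup>2 \<le> 4 * (card D + Suc k)\<^sup>2"
    by (simp add: power_mult_distrib power_mono)
  also have "\<dots> \<le> r\<^sup>2"
    using Suc.prems(3) sq by linarith
  finally have "2 * card D \<le> card R"
    unfolding r_def by (rule power2_le_imp_le) simp
  moreover have "0 < card R"
    using sq Suc.prems(4) by (auto simp: r_def intro: Nat.gr0I)
  ultimately obtain h where h: "h \<in> Zmod m" "h \<notin> D"
    and pop: "r\<^sup>2 \<le> 2 * m * card {x \<in> R. (x + h) mod int m \<in> R}"
    using popular_difference[OF Suc.prems(1,2)] unfolding r_def by blast
  define R' where "R' = {x \<in> R. (x + h) mod int m \<in> R}"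
  have "(4 * m) ^ ?K * (4 * m) ^ (?K - 1) = (4 * m) ^ (?K + (?K - 1))"
    by (rule power_add[symmetric])
  also have "\<dots> \<le> (r\<^sup>2) ^ ?K"
    by (rule size)
  also have "\<dots> \<le> (2 * m * card R') ^ ?K"
    unfolding R'_def by (rule power_mono[OF pop]) simp
  also have "\<dots> \<le> (4 * m * card R') ^ ?K"
    by (intro power_mono) auto
  also have "\<dots> = (4 * m) ^ ?K * card R' ^ ?K"
    by (simp add: power_mult_distrib)
  finally have size': "(4 * m) ^ (?K - 1) \<le> card R' ^ ?K"
    using Suc.prems(4) by (subst (asm) mult_le_cancel1) auto
  have "card (insert h D) = Suc (card D)"
    using h Suc.prems(2) finite_subset by fastforce
  then have "(card (insert h D) + k)\<^sup>2 \<le> m"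
    using Suc.prems(3) by simp
  moreover have "R' \<subseteq> Zmod m" "insert h D \<subseteq> Zmod m"
    using Suc.prems(1,2) h by (auto simp: R'_def)
  ultimately obtain x0 X where x0: "x0 \<in> Zmod m" and X: "X \<subseteq> Zmod m - insert h D" "card X = k"
    and cube: "\<And>T. T \<subseteq> X \<Longrightarrow> (x0 + \<Sum>T) mod int m \<in> R'"
    using Suc.IH[of R' "insert h D"] size' Suc.prems(4) by blast
  have finX: "finite X"
    using X(1) finite_subset[OF _ finite_Zmod] by blast
  have "(x0 + \<Sum>T) mod int m \<in> R" if T: "T \<subseteq> insert h X" for T
  proof (cases "h \<in> T")
    case False
    then show ?thesis
      using T cube[of T] by (auto simp: R'_def)
  next
    case True
    have "finite T"
      using T finX finite_subset by blast
    then have "\<Sum>T = h + \<Sum>(T - {h})"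
      using True by (simp add: sum.remove)
    moreover have "((x0 + \<Sum>(T - {h})) mod int m + h) mod int m \<in> R"
      using T cube[of "T - {h}"] by (auto simp: R'_def)
    ultimately show ?thesis
      by (simp add: mod_add_left_eq mod_add_right_eq add_ac)
  qed
  moreover have "insert h X \<subseteq> Zmod m - D" "card (insert h X) = Suc k"
    using X h finX by (auto simp: card_insert_if)
  ultimately show ?case
    using x0 by blast
qed

lemma not_midlayer_free_if_large:
  assumes "R \<subseteq> Zmod m" "(2 * t)\<^sup>2 \<le> m" "0 < m"
    and "(4 * m) ^ (2 ^ (2 * t) - 1) \<le> card R ^ 2 ^ (2 * t)"
  shows "\<not> midlayer_free m t R"
proof -
  obtain x0 X where "x0 \<in> Zmod m" "X \<subseteq> Zmod m" "card X = 2 * t"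
    and cube: "\<And>T. T \<subseteq> X \<Longrightarrow> (x0 + \<Sum>T) mod int m \<in> R"
    using distinct_hilbert_cube[of R m "{}" "2 * t"] assms by auto
  moreover have "translate m x0 (midlayer_sums m t X) \<subseteq> R"
    using cube by (auto simp: translate_def midlayer_sums_def mod_add_right_eq)
  ultimately show ?thesis
    unfolding midlayer_free_def by blast
qed

text \<open>The maximum is over a finite set, nonempty because \<open>R = {}\<close> is admissible: a set of \<open>2 t\<close>
  elements has a subset of size \<open>t\<close>, so no sum set is empty.\<close>

lemma g_attained:
  "\<exists>R. R \<subseteq> Zmod m \<and> midlayer_free m t R \<and> card R = g m t"
proof -
  let ?A = "{card R |R. R \<subseteq> Zmod m \<and> midlayer_free m t R}"
  have "midlayer_sums m t X \<noteq> {}" if "card X = 2 * t" for X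
    using obtain_subset_with_card_n[of t X] that by (fastforce simp: midlayer_sums_def)
  then have "midlayer_free m t {}"
    by (auto simp: midlayer_free_def translate_def)
  then have "?A \<noteq> {}"
    by blast
  moreover have "finite ?A"
    by (rule finite_subset[of _ "card ` Pow (Zmod m)"]) auto
  ultimately have "g m t \<in> ?A"
    unfolding g_def by (rule Max_in[rotated])
  then show ?thesis
    by auto
qed

lemma power_le_of_powr_less:
  assumes "0 < a" and "real a powr (1 - 1 / 2 ^ d) < real b"
  shows "a ^ (2 ^ d - 1) \<le> b ^ 2 ^ d"
proof -
  have exponent: "real (2 ^ d) * (1 - 1 / 2 ^ d) = real (2 ^ d - 1)"
    by (simp add: of_nat_diff field_simps)
  have "(real a powr (1 - 1 / 2 ^ d)) ^ 2 ^ d = real a powr (real (2 ^ d) * (1 - 1 / 2 ^ d))"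
    using assms(1) by (simp add: powr_power mult.commute)
  also have "\<dots> = real a ^ (2 ^ d - 1)"
    unfolding exponent using assms(1) by (intro powr_realpow) simp
  finally have "(real a powr (1 - 1 / 2 ^ d)) ^ 2 ^ d = real a ^ (2 ^ d - 1)" .
  moreover have "(real a powr (1 - 1 / 2 ^ d)) ^ 2 ^ d \<le> real b ^ 2 ^ d"
    using assms(2) by (intro power_mono) auto
  ultimately show ?thesis
    by (simp flip: of_nat_power)
qed

theorem theorem1p9:
  fixes t :: nat
  assumes "t \<ge> 2"
  shows "\<exists>m0::nat. \<forall>m\<ge>m0.
    real (g m t) \<le> 4 powr (1 - 1 / 2 ^ (2 * t))
      * (sqrt (real m) + sqrt (2 * real t)) powr (2 - 1 / 2 ^ (2 * t - 1))"
proof (intro exI[of _ "(2 * t)\<^sup>2"] allI impI)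
  fix m :: nat
  assume m: "(2 * t)\<^sup>2 \<le> m"
  have mpos: "0 < m"
    using m assms by (auto intro: Nat.gr0I)
  let ?e = "1 - 1 / 2 ^ (2 * t) :: real"
  have e: "2 - 1 / 2 ^ (2 * t - 1) = 2 * ?e" "0 \<le> ?e"
    using assms by (simp_all add: power_diff)
  obtain R where R: "R \<subseteq> Zmod m" "midlayer_free m t R" and g: "card R = g m t"
    using g_attained by blast
  have "real (g m t) \<le> real (4 * m) powr ?e"
    using not_midlayer_free_if_large[OF R(1) m mpos] R(2) power_le_of_powr_less[of "4 * m" "2 * t"]
      mpos
    unfolding g by (meson not_le mult_pos_pos zero_less_numeral)
  also have "\<dots> = 4 powr ?e * sqrt (real m) powr (2 * ?e)"
  proof -
    have "sqrt (real m) powr (2 * ?e) = real m powr ?e"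
      using mpos powr_powr[of "sqrt (real m)" 2 ?e] by simp
    then show ?thesis
      by (simp add: powr_mult)
  qed
  also have "\<dots> \<le> 4 powr ?e * (sqrt (real m) + sqrt (2 * real t)) powr (2 * ?e)"
    by (intro mult_left_mono powr_mono2 mult_nonneg_nonneg e(2)) auto
  finally show "real (g m t) \<le> 4 powr ?e
      * (sqrt (real m) + sqrt (2 * real t)) powr (2 - 1 / 2 ^ (2 * t - 1))"
    unfolding e(1) .
qed

end
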